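(* Suppose $P\subset\mathbb{R}^d$ is a rational generic orthotope. For each vertex $v$ of $P$, denote its coordinates by $v=(v_1,v_2,\dots,v_d)$. Then $$\mathrm{volume}(P)=\sum_v \tau(v)\prod_{i=1}^d v_i,$$ where the sum is over all vertices $v$ of $P$ and $\tau(v)$ denotes the signed volume of the floral arrangement (the tangent cone) of $P$ at $v$.
   Context: **Floral vertices.** A series-parallel diagram (SPD) is defined inductively as a single edge joining two terminals, a series connection $\Delta_1\wedge\Delta_2$ of SPDs, or a parallel connection $\Delta_1\vee\Delta_2$ of SPDs; the edges are all distinct (so an SPD is a read-once formula in $\wedge,\vee$). The single vertex is also admitted as an SPD, with no edges. A signed SPD is a pair $(\Delta,s)$ with $s:E(\Delta)\to\{\pm1\}$, where $E(\Delta)$ is the edge set. Let $H_i=\{x\in\mathbb{R}^d: x_i\ge 0\}$. If $E(\Delta)=\{1,\dots,d\}$, the floral vertex in $\mathbb{R}^d$ determined by $(\Delta,s)$ is the set obtained by interpreting edge $i$ as $s_iH_i$, series connection as intersection and parallel connection as union. **Signed volume.** For $s\in\{\pm1\}^d$ the orthant $\Omega_s$ is $\{x: s_ix_i\ge0\ \forall i\}$, with sign $\prod_i s_i$. A local orthotopal arrangement is a union of orthants. The signed volume of a floral vertex in $\mathbb{R}^d$ is the sum of the signs of the orthants it contains. **Orthogonal polytopes.** An axis-aligned box is a product $\prod_{i=1}^d[a_i,b_i]$ with $a_i\le b_i$; it is pure $d$-dimensional if all $a_i<b_i$. An orthogonal polytope is a union of a finite set of axis-aligned boxes; it is pure $d$-dimensional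 if the boxes can be taken pure $d$-dimensional. It is integral if it equals $\bigcup_{v\in S}(v+f_v)$ with $S\subset\mathbb{Z}^d$ finite and each $f_v$ a face of the unit cube $[0,1]^d$; $P$ is rational if $nP$ is integral for some positive integer $n$. For $P$ pure $d$-dimensional, the tangent cone of $P$ at $v\in P$ is the local orthotopal arrangement $\alpha$ such that for some $\delta>0$, $P\cap(v+[-\delta,\delta]^d)=v+(\alpha\cap[-\delta,\delta]^d)$. The genericity region of $v\in P$ is the set of points of $P$ joined to $v$ by a path along which every tangent cone is congruent (under signed coordinate permutations) to the one at $v$. Its degree is the smallest dimension of a set of the form $\{x:x_i=\lambda_i\ \forall i\in I\}$ ($I\subset\{1,\dots,d\}$) containing it. A point is singular, or a vertex of $P$, if its genericity region has degree $0$. **Generic orthotope.** A generic orthotope of dimension $d$ is a pure $d$-dimensional orthogonal polytope in $\mathbb{R}^d$ such that the tangent cone at every singular point is a floral vertex on $d$ half-spaces.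
   Formalization: The formula proved has an extra factor (-1)^d before the sum; without it the claim fails for odd d (d=1, P=[0,1]: the vertex sum is -1, the volume is 1). For even d it is the printed formula. The dimension is d ≥ 1. *)

theory Defs
  imports "HOL-Analysis.Analysis"
begin

section \<open>Floral vertices\<close>

text \<open>The single-vertex diagram has no edges, so it only determines the floral vertex of the
  zero-dimensional space, which is not of the form \<^typ>\<open>real ^ 'n\<close>; hence it has no constructor.\<close>

datatype (edges: 'e) spd =
    Edge 'e
  | Series "'e spd" "'e spd"
  | Parallel "'e spd" "'e spd"

primrec distinct_edges :: "'e spd \<Rightarrow> bool" where
  "distinct_edges (Edge e) = True"
| "distinct_edges (Series D1 D2) =
    (distinct_edges D1 \<and> distinct_edges D2 \<and> edges D1 \<inter> edges D2 = {})"
| "distinct_edges (Parallel D1 D2) =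
    (distinct_edges D1 \<and> distinct_edges D2 \<and> edges D1 \<inter> edges D2 = {})"

definition sign_function :: "('e \<Rightarrow> real) \<Rightarrow> bool" where
  "sign_function s \<longleftrightarrow> (\<forall>e. s e = 1 \<or> s e = -1)"

definition half_space :: "'n::finite \<Rightarrow> (real ^ 'n) set" where
  "half_space i = {x. x $ i \<ge> 0}"

primrec spd_set :: "('n::finite \<Rightarrow> real) \<Rightarrow> 'n spd \<Rightarrow> (real ^ 'n) set" where
  "spd_set s (Edge i) = (\<lambda>x. s i *\<^sub>R x) ` half_space i"
| "spd_set s (Series D1 D2) = spd_set s D1 \<inter> spd_set s D2"
| "spd_set s (Parallel D1 D2) = spd_set s D1 \<union> spd_set s D2"

definition floral_vertex :: "(real ^ 'n::finite) set \<Rightarrow> bool" where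
  "floral_vertex \<alpha> \<longleftrightarrow>
     (\<exists>D s. distinct_edges D \<and> edges D = UNIV \<and> sign_function s \<and> \<alpha> = spd_set s D)"

section \<open>Orthants and signed volume\<close>

definition orthant :: "('n::finite \<Rightarrow> real) \<Rightarrow> (real ^ 'n) set" where
  "orthant s = {x. \<forall>i. s i * x $ i \<ge> 0}"

definition local_arrangement :: "(real ^ 'n::finite) set \<Rightarrow> bool" where
  "local_arrangement \<alpha> \<longleftrightarrow> (\<exists>S. (\<forall>s\<in>S. sign_function s) \<and> \<alpha> = (\<Union>s\<in>S. orthant s))"

text \<open>With this sign, the cone of the unit cube at \<open>(1,\<dots>,1)\<close> is the all-negative orthant and has
  signed volume \<open>(-1)^d\<close>; so vertex sums compute the volume up to the factor \<open>(-1)^d\<close>.\<close>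

definition signed_volume :: "(real ^ 'n::finite) set \<Rightarrow> real" where
  "signed_volume \<alpha> = (\<Sum>s | sign_function s \<and> orthant s \<subseteq> \<alpha>. \<Prod>i\<in>UNIV. s i)"

section \<open>Orthogonal polytopes\<close>

definition pure_orthogonal_polytope :: "(real ^ 'n::finite) set \<Rightarrow> bool" where
  "pure_orthogonal_polytope P \<longleftrightarrow>
     (\<exists>\<B>. finite \<B> \<and> (\<forall>B\<in>\<B>. \<exists>a b. (\<forall>i. a $ i < b $ i) \<and> B = cbox a b) \<and> P = \<Union>\<B>)"

text \<open>The relation \<^const>\<open>face_of\<close> counts the empty set as a face; this makes no difference here,
  since points with an empty face can be dropped from the index set.\<close>

definition integral_polytope :: "(real ^ 'n::finite) set \<Rightarrow> bool" where
  "integral_polytope P \<longleftrightarrow>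
     (\<exists>S f. finite S \<and> (\<forall>v\<in>S. (\<forall>i. v $ i \<in> \<int>) \<and> f v face_of cbox 0 1)
        \<and> P = (\<Union>v\<in>S. (\<lambda>x. v + x) ` f v))"

definition rational_polytope :: "(real ^ 'n::finite) set \<Rightarrow> bool" where
  "rational_polytope P \<longleftrightarrow> (\<exists>n::nat. n > 0 \<and> integral_polytope ((\<lambda>x. real n *\<^sub>R x) ` P))"

section \<open>Tangent cones and vertices\<close>

definition centered_cube :: "real \<Rightarrow> (real ^ 'n::finite) set" where
  "centered_cube \<delta> = {x. \<forall>i. - \<delta> \<le> x $ i \<and> x $ i \<le> \<delta>}"

text \<open>Local arrangements are invariant under positive scaling, so there is at most one tangent cone
  at a point; for a pure orthogonal polytope and one of its points there is exactly one.\<close>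

definition tangent_cone :: "(real ^ 'n::finite) set \<Rightarrow> real ^ 'n \<Rightarrow> (real ^ 'n) set" where
  "tangent_cone P v = (THE \<alpha>. local_arrangement \<alpha> \<and>
     (\<exists>\<delta>>0. P \<inter> (\<lambda>x. v + x) ` centered_cube \<delta> = (\<lambda>x. v + x) ` (\<alpha> \<inter> centered_cube \<delta>)))"

definition congruent_cones :: "(real ^ 'n::finite) set \<Rightarrow> (real ^ 'n) set \<Rightarrow> bool" where
  "congruent_cones \<alpha> \<beta> \<longleftrightarrow>
     (\<exists>\<pi> \<epsilon>. bij \<pi> \<and> sign_function \<epsilon> \<and> \<beta> = (\<lambda>x. \<chi> i. \<epsilon> i * x $ \<pi> i) ` \<alpha>)"

definition genericity_region :: "(real ^ 'n::finite) set \<Rightarrow> real ^ 'n \<Rightarrow> (real ^ 'n) set" where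
  "genericity_region P v =
     {w. \<exists>\<gamma>. path \<gamma> \<and> path_image \<gamma> \<subseteq> P \<and> pathstart \<gamma> = v \<and> pathfinish \<gamma> = w \<and>
        (\<forall>y\<in>path_image \<gamma>. congruent_cones (tangent_cone P y) (tangent_cone P v))}"

definition coordinate_flat :: "'n::finite set \<Rightarrow> ('n \<Rightarrow> real) \<Rightarrow> (real ^ 'n) set" where
  "coordinate_flat I c = {x. \<forall>i\<in>I. x $ i = c i}"

definition degree :: "(real ^ 'n::finite) set \<Rightarrow> real ^ 'n \<Rightarrow> nat" where
  "degree P v = (LEAST k. \<exists>I c. genericity_region P v \<subseteq> coordinate_flat I c \<and>
     aff_dim (coordinate_flat I c) = int k)"

definition vertices :: "(real ^ 'n::finite) set \<Rightarrow> (real ^ 'n) set" where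
  "vertices P = {v \<in> P. degree P v = 0}"

definition generic_orthotope :: "(real ^ 'n::finite) set \<Rightarrow> bool" where
  "generic_orthotope P \<longleftrightarrow>
     pure_orthogonal_polytope P \<and> (\<forall>v\<in>vertices P. floral_vertex (tangent_cone P v))"

end

theory Submission
  imports Defs
begin

text \<open>The tangent cone and its signed volume make sense at every point of a grid containing all
  corners of the boxes of \<open>P\<close>, and summing \<open>signed_volume (tangent_cone P v) * (\<Prod>i. v $ i)\<close> over all
  grid points gives a valuation. By inclusion-exclusion it suffices to evaluate it on a single
  box, where it factors into \<open>\<Prod>i. a $ i - b $ i\<close>. A grid point that is not a vertex
  contributes nothing: its tangent cone is empty or invariant under a coordinate reflection, and then
  orthants of opposite sign cancel. Hence only the vertices remain in the sum.\<close>

section \<open>Local arrangements\<close>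

definition reflect :: "'n::finite \<Rightarrow> real ^ 'n \<Rightarrow> real ^ 'n" where
  "reflect k x = (\<chi> i. if i = k then - x $ i else x $ i)"

lemma reflect_reflect [simp]: "reflect k (reflect k x) = x"
  by (simp add: reflect_def vec_eq_iff)

lemma sign_functions_eq_PiE: "{s. sign_function s} = PiE UNIV (\<lambda>_. {1, -1})"
  by (auto simp: sign_function_def PiE_iff)

lemma finite_sign_functions: "finite {s :: 'n::finite \<Rightarrow> real. sign_function s}"
  unfolding sign_functions_eq_PiE by (rule finite_PiE) auto

lemma sign_function_flip: "sign_function s \<Longrightarrow> sign_function (s(k := - s k))"
  by (auto simp: sign_function_def)

lemma reflect_in_orthant_flip: "reflect k x \<in> orthant (s(k := - s k)) \<longleftrightarrow> x \<in> orthant s"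
proof -
  have "(s(k := - s k)) i * reflect k x $ i = s i * x $ i" for i
    by (simp add: reflect_def)
  then show ?thesis
    unfolding orthant_def by simp
qed

lemma orthant_scaleR_iff:
  assumes "t > 0"
  shows "t *\<^sub>R x \<in> orthant s \<longleftrightarrow> x \<in> orthant s"
proof -
  have "s i * (t *\<^sub>R x) $ i = t * (s i * x $ i)" for i by simp
  then have "0 \<le> s i * (t *\<^sub>R x) $ i \<longleftrightarrow> 0 \<le> s i * x $ i" for i
    using assms by (simp only: zero_le_mult_iff[of t]) auto
  then show ?thesis unfolding orthant_def by blast
qed

lemma local_arrangement_UN_orthant:
  "(\<And>s. s \<in> S \<Longrightarrow> sign_function s) \<Longrightarrow> local_arrangement (\<Union>s\<in>S. orthant s)"
  unfolding local_arrangement_def by (intro exI[of _ S]) simp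

lemma local_arrangement_scaleR_iff:
  assumes "local_arrangement \<alpha>" "t > 0"
  shows "t *\<^sub>R x \<in> \<alpha> \<longleftrightarrow> x \<in> \<alpha>"
  using assms(1) orthant_scaleR_iff[OF assms(2)] by (auto simp: local_arrangement_def)

text \<open>The sign vector \<open>s\<close> itself lies in its own orthant and in no other, so a
  union of orthants determines its index set.\<close>

lemma orthant_subset_UN_iff:
  assumes "sign_function s" "\<And>s'. s' \<in> S \<Longrightarrow> sign_function s'"
  shows "orthant s \<subseteq> (\<Union>s'\<in>S. orthant s') \<longleftrightarrow> s \<in> S"
proof
  assume "orthant s \<subseteq> (\<Union>s'\<in>S. orthant s')"
  moreover have "(\<chi> i. s i) \<in> orthant s" by (simp add: orthant_def)
  ultimately obtain s' where s': "s' \<in> S" "(\<chi> i. s i) \<in> orthant s'" by blast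
  have "s' i = s i" for i
  proof -
    have "s' i * s i \<ge> 0" using s'(2) by (simp add: orthant_def)
    moreover have "s' i = 1 \<or> s' i = -1" "s i = 1 \<or> s i = -1"
      using assms s'(1) by (auto simp: sign_function_def)
    ultimately show ?thesis by auto
  qed
  with s'(1) show "s \<in> S" by (metis ext)
qed blast

lemma signed_volume_UN_orthant:
  assumes "\<And>s. s \<in> S \<Longrightarrow> sign_function s"
  shows "signed_volume (\<Union>s\<in>S. orthant s) = (\<Sum>s\<in>S. \<Prod>i\<in>UNIV. s i)"
proof -
  have "{s. sign_function s \<and> orthant s \<subseteq> (\<Union>s\<in>S. orthant s)} = S"
    using assms orthant_subset_UN_iff[OF _ assms] by blast
  then show ?thesis by (simp add: signed_volume_def)
qed

text \<open>Flipping the \<open>k\<close>-th sign is an involution on the orthants contained in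
  \<open>\<alpha>\<close> and negates every sign product, so the sum equals its own
  negative.\<close>

lemma signed_volume_reflect_invariant:
  assumes "reflect k ` \<alpha> \<subseteq> \<alpha>"
  shows "signed_volume \<alpha> = 0"
proof -
  define A where "A = {s. sign_function s \<and> orthant s \<subseteq> \<alpha>}"
  define h where "h = (\<lambda>s :: 'a \<Rightarrow> real. s(k := - s k))"
  have hh: "h (h s) = s" for s by (simp add: h_def)
  have hA: "h s \<in> A" if "s \<in> A" for s
  proof -
    have "orthant (h s) \<subseteq> \<alpha>"
    proof
      fix x assume "x \<in> orthant (h s)"
      then have "reflect k x \<in> orthant s"
        using reflect_in_orthant_flip[of k "reflect k x" s] by (simp add: h_def)
      then have "reflect k x \<in> \<alpha>" using that by (auto simp: A_def)
      then show "x \<in> \<alpha>" using assms by (metis image_subset_iff reflect_reflect)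
    qed
    with that show ?thesis by (auto simp: A_def h_def sign_function_flip)
  qed
  have prod_h: "(\<Prod>i\<in>UNIV. h s i) = - (\<Prod>i\<in>UNIV. s i)" for s
    by (simp add: h_def prod.remove[of UNIV k])
  have "(\<Sum>s\<in>A. \<Prod>i\<in>UNIV. s i) = (\<Sum>s\<in>A. \<Prod>i\<in>UNIV. h s i)"
    by (rule sum.reindex_bij_witness[of _ h h]) (auto simp: hh hA)
  also have "\<dots> = - (\<Sum>s\<in>A. \<Prod>i\<in>UNIV. s i)"
    by (simp add: prod_h sum_negf)
  finally show ?thesis by (simp add: signed_volume_def A_def)
qed

text \<open>Signed permutations conjugate coordinate reflections to coordinate reflections;
  \<open>k\<close> is the index that \<open>\<pi>\<close> sends to \<open>j\<close>. Needed because
  genericity regions compare cones only up to congruence.\<close>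

lemma congruent_reflect_invariant:
  assumes "congruent_cones \<alpha> \<beta>" "reflect j ` \<alpha> \<subseteq> \<alpha>"
  obtains k where "reflect k ` \<beta> \<subseteq> \<beta>"
proof -
  obtain \<pi> \<epsilon> where "bij \<pi>" and \<beta>: "\<beta> = (\<lambda>x. \<chi> i. \<epsilon> i * x $ \<pi> i) ` \<alpha>"
    using assms(1) unfolding congruent_cones_def by blast
  then obtain k where k: "\<pi> i = j \<longleftrightarrow> i = k" for i
    by (metis bij_pointE)
  have "reflect k (\<chi> i. \<epsilon> i * x $ \<pi> i) = (\<chi> i. \<epsilon> i * reflect j x $ \<pi> i)" for x
    by (simp add: reflect_def vec_eq_iff k)
  then have "reflect k ` \<beta> \<subseteq> \<beta>" using assms(2) unfolding \<beta> by auto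
  then show ?thesis by (rule that)
qed

lemma congruent_cones_refl: "congruent_cones \<alpha> \<alpha>"
  unfolding congruent_cones_def
  by (intro exI[of _ id] exI[of _ "\<lambda>_. 1"]) (simp add: sign_function_def vec_lambda_eta)

text \<open>Reduces the definite description to one local check. Two candidates agree because both
  are invariant under positive scaling and every \<open>x\<close> can be scaled into both
  cubes.\<close>

lemma tangent_cone_eqI:
  fixes P :: "(real ^ 'n::finite) set"
  assumes "local_arrangement \<alpha>" "\<delta> > 0"
    and "\<And>x. x \<in> centered_cube \<delta> \<Longrightarrow> v + x \<in> P \<longleftrightarrow> x \<in> \<alpha>"
  shows "tangent_cone P v = \<alpha>"
  unfolding tangent_cone_def
proof (rule the_equality)
  show "local_arrangement \<alpha> \<and> (\<exists>\<delta>>0. P \<inter> (\<lambda>x. v + x) ` centered_cube \<delta>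
      = (\<lambda>x. v + x) ` (\<alpha> \<inter> centered_cube \<delta>))"
    using assms by (intro conjI exI[of _ \<delta>]) auto
next
  fix \<beta> assume "local_arrangement \<beta> \<and> (\<exists>\<delta>>0. P \<inter> (\<lambda>x. v + x) ` centered_cube \<delta>
      = (\<lambda>x. v + x) ` (\<beta> \<inter> centered_cube \<delta>))"
  then obtain \<eta> where \<beta>: "local_arrangement \<beta>" and "\<eta> > 0"
    and eq: "P \<inter> (\<lambda>x. v + x) ` centered_cube \<eta> = (\<lambda>x. v + x) ` (\<beta> \<inter> centered_cube \<eta>)"
    by blast
  have in_\<beta>: "v + x \<in> P \<longleftrightarrow> x \<in> \<beta>" if "x \<in> centered_cube \<eta>" for x
  proof -
    have "v + x \<in> (\<lambda>x. v + x) ` A \<longleftrightarrow> x \<in> A" for A by auto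
    then show ?thesis using eq that by (metis (no_types, lifting) IntD1 IntI)
  qed
  show "\<beta> = \<alpha>"
  proof (rule set_eqI)
    fix x :: "real ^ 'n"
    \<comment> \<open>Coordinates are bounded by the norm, so this factor brings \<open>x\<close>
      into both cubes; the summand 1 keeps the denominator positive at \<open>x = 0\<close>.\<close>
    define t where "t = min \<delta> \<eta> / (1 + norm x)"
    have "t > 0" using assms(2) \<open>\<eta> > 0\<close> by (simp add: t_def add_pos_nonneg)
    have "\<bar>(t *\<^sub>R x) $ i\<bar> \<le> min \<delta> \<eta>" for i
    proof -
      have "\<bar>(t *\<^sub>R x) $ i\<bar> = t * \<bar>x $ i\<bar>" using \<open>t > 0\<close> by (simp add: abs_mult)
      also have "\<dots> \<le> t * (1 + norm x)"
        using \<open>t > 0\<close> component_le_norm_cart[of x i] by (intro mult_left_mono) auto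
      also have "\<dots> = min \<delta> \<eta>"
        using norm_ge_zero[of x] by (simp add: t_def del: norm_ge_zero)
      finally show ?thesis .
    qed
    then have "t *\<^sub>R x \<in> centered_cube \<delta>" "t *\<^sub>R x \<in> centered_cube \<eta>"
      by (auto simp: centered_cube_def abs_le_iff minus_le_iff simp del: vector_scaleR_component)
    then have "t *\<^sub>R x \<in> \<beta> \<longleftrightarrow> t *\<^sub>R x \<in> \<alpha>" using assms(3) in_\<beta> by blast
    then show "x \<in> \<beta> \<longleftrightarrow> x \<in> \<alpha>"
      using local_arrangement_scaleR_iff \<open>t > 0\<close> \<beta> assms(1) by blast
  qed
qed

section \<open>Unions of boxes with corners in a finite grid\<close>

definition grid_boxes :: "real set \<Rightarrow> (real ^ 'n::finite) set set" where
  "grid_boxes C = {cbox a b |a b. \<forall>i. a $ i \<in> C \<and> b $ i \<in> C \<and> a $ i \<le> b $ i}"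

definition pure_grid_boxes :: "real set \<Rightarrow> (real ^ 'n::finite) set set" where
  "pure_grid_boxes C = {cbox a b |a b. \<forall>i. a $ i \<in> C \<and> b $ i \<in> C \<and> a $ i < b $ i}"

text \<open>For \<open>\<epsilon>\<close> smaller than the gaps of \<open>C\<close>, the inner sum is the signed volume of the tangent cone
  at \<open>v\<close>. In this form the sum is visibly additive in the indicator function of \<open>A\<close>, and it makes
  sense for lower-dimensional intersections of boxes as well.\<close>

definition grid_sum :: "real set \<Rightarrow> real \<Rightarrow> (real ^ 'n::finite) set \<Rightarrow> real" where
  "grid_sum C \<epsilon> A = (\<Sum>v | \<forall>i. v $ i \<in> C.
     (\<Sum>s | sign_function s. (\<Prod>i\<in>UNIV. s i) * indicator A (v + \<epsilon> *\<^sub>R (\<chi> i. s i))) * (\<Prod>i\<in>UNIV. v $ i))"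

section \<open>The grid sum of a single box\<close>

lemma grid_points_eq: "{v :: real ^ 'n::finite. \<forall>i. v $ i \<in> C} = vec_lambda ` PiE UNIV (\<lambda>_. C)"
proof (intro set_eqI iffI)
  fix v :: "real ^ 'n" assume "v \<in> {v. \<forall>i. v $ i \<in> C}"
  then have "v = vec_lambda (vec_nth v)" "vec_nth v \<in> PiE UNIV (\<lambda>_. C)"
    by (auto simp: vec_lambda_eta)
  then show "v \<in> vec_lambda ` PiE UNIV (\<lambda>_. C)" by blast
qed (auto simp: PiE_iff)

lemma finite_grid_points: "finite C \<Longrightarrow> finite {v :: real ^ 'n::finite. \<forall>i. v $ i \<in> C}"
  unfolding grid_points_eq by (intro finite_imageI finite_PiE) auto

text \<open>The sum factors over the coordinates. The test values \<open>v $ i + \<epsilon>\<close>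
  and \<open>v $ i - \<epsilon>\<close> lie both inside or both outside the interval unless
  \<open>v $ i\<close> is an endpoint of a nondegenerate one: the lower endpoint keeps only the sign
  1, the upper only -1.\<close>

lemma cbox_sign_sum:
  fixes a b v :: "real ^ 'n::finite"
  assumes "\<epsilon> > 0" "\<And>c c'. c \<in> C \<Longrightarrow> c' \<in> C \<Longrightarrow> c \<noteq> c' \<Longrightarrow> \<epsilon> < \<bar>c - c'\<bar>"
    and ab: "\<And>i. a $ i \<in> C \<and> b $ i \<in> C \<and> a $ i \<le> b $ i" and v: "\<And>i. v $ i \<in> C"
  shows "(\<Sum>s | sign_function s. (\<Prod>i\<in>UNIV. s i) * indicator (cbox a b) (v + \<epsilon> *\<^sub>R (\<chi> i. s i)))
    = (\<Prod>i\<in>UNIV. of_bool (v $ i = a $ i) - of_bool (v $ i = b $ i))"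
proof -
  have ind: "indicator (cbox a b) (v + \<epsilon> *\<^sub>R (\<chi> i. s i))
      = (\<Prod>i\<in>UNIV. indicator {a $ i..b $ i} (v $ i + \<epsilon> * s i) :: real)" for s
    by (auto simp: indicator_def mem_box_cart prod_zero_iff)
  have "(\<Sum>s | sign_function s. (\<Prod>i\<in>UNIV. s i) * indicator (cbox a b) (v + \<epsilon> *\<^sub>R (\<chi> i. s i)))
    = (\<Sum>s\<in>PiE UNIV (\<lambda>_. {1, -1}). \<Prod>i\<in>UNIV. s i * indicator {a $ i..b $ i} (v $ i + \<epsilon> * s i))"
    by (simp add: ind prod.distrib sign_functions_eq_PiE)
  also have "\<dots> = (\<Prod>i\<in>UNIV. \<Sum>\<sigma>\<in>{1, -1}. \<sigma> * indicator {a $ i..b $ i} (v $ i + \<epsilon> * \<sigma>))"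
    by (rule prod_sum_PiE[symmetric]) auto
  also have "\<dots> = (\<Prod>i\<in>UNIV. of_bool (v $ i = a $ i) - of_bool (v $ i = b $ i))"
  proof (rule prod.cong)
    fix i
    have sum2: "(\<Sum>\<sigma>\<in>{1, -1}. f \<sigma>) = f 1 + f (-1)" for f :: "real \<Rightarrow> real" by simp
    consider "v $ i \<noteq> a $ i" "v $ i \<noteq> b $ i" | "v $ i = a $ i" "v $ i \<noteq> b $ i"
      | "v $ i \<noteq> a $ i" "v $ i = b $ i" | "v $ i = a $ i" "v $ i = b $ i"
      by blast
    then show "(\<Sum>\<sigma>\<in>{1, -1}. \<sigma> * indicator {a $ i..b $ i} (v $ i + \<epsilon> * \<sigma>))
      = (of_bool (v $ i = a $ i) - of_bool (v $ i = b $ i) :: real)"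
      using assms(1) ab[of i] v[of i] assms(2)[of "v $ i" "a $ i"] assms(2)[of "v $ i" "b $ i"]
      unfolding sum2 by cases (auto simp: indicator_def)
  qed simp
  finally show ?thesis .
qed

text \<open>Only corners of the box carry weight, and the sum over them factors into the differences
  \<open>a $ i - b $ i\<close>: the volume up to one factor -1 per dimension.\<close>

lemma grid_sum_cbox:
  fixes a b :: "real ^ 'n::finite"
  assumes "finite C" "\<epsilon> > 0" "\<And>c c'. c \<in> C \<Longrightarrow> c' \<in> C \<Longrightarrow> c \<noteq> c' \<Longrightarrow> \<epsilon> < \<bar>c - c'\<bar>"
    and ab: "\<And>i. a $ i \<in> C \<and> b $ i \<in> C \<and> a $ i \<le> b $ i"
  shows "measure lebesgue (cbox a b) = (- 1) ^ CARD('n) * grid_sum C \<epsilon> (cbox a b)"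
proof -
  \<comment> \<open>The weight of one coordinate: \<open>x\<close> at the lower end,
    \<open>- x\<close> at the upper end, and 0 throughout if the ends coincide.\<close>
  define w :: "'n \<Rightarrow> real \<Rightarrow> real" where
    "w = (\<lambda>i x. (of_bool (x = a $ i) - of_bool (x = b $ i)) * x)"
  have "grid_sum C \<epsilon> (cbox a b) = (\<Sum>v | \<forall>i. v $ i \<in> C. \<Prod>i\<in>UNIV. w i (v $ i))"
    unfolding grid_sum_def
    by (intro sum.cong) (auto simp: cbox_sign_sum[OF assms(2,3) ab] w_def prod.distrib)
  also have "\<dots> = (\<Sum>g\<in>PiE UNIV (\<lambda>_. C). \<Prod>i\<in>UNIV. w i (g i))"
    unfolding grid_points_eq
    by (subst sum.reindex) (auto simp: inj_on_def vec_lambda_inject)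
  also have "\<dots> = (\<Prod>i\<in>UNIV. \<Sum>x\<in>C. w i x)"
    using assms(1) by (intro prod_sum_PiE[symmetric]) auto
  also have "\<dots> = (\<Prod>i\<in>UNIV. - (b $ i - a $ i))"
  proof (rule prod.cong)
    fix i
    have "(\<Sum>x\<in>C. w i x) = (\<Sum>x\<in>C. if x = a $ i then x else 0) - (\<Sum>x\<in>C. if x = b $ i then x else 0)"
      unfolding w_def sum_subtractf[symmetric] by (intro sum.cong) (auto simp: algebra_simps)
    also have "\<dots> = - (b $ i - a $ i)"
      using assms(1) ab[of i] by (simp add: sum.delta)
    finally show "(\<Sum>x\<in>C. w i x) = - (b $ i - a $ i)" .
  qed simp
  also have "\<dots> = (- 1) ^ CARD('n) * (\<Prod>i\<in>UNIV. b $ i - a $ i)"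
    by (subst prod_uminus) simp
  finally have "(- 1) ^ CARD('n) * grid_sum C \<epsilon> (cbox a b) = (\<Prod>i\<in>UNIV. b $ i - a $ i)"
    by (simp flip: mult.assoc power_mult_distrib)
  moreover have "cbox a b \<noteq> {}"
    using ab by (auto simp: interval_ne_empty_cart)
  ultimately show ?thesis
    by (simp add: content_cbox_cart)
qed

section \<open>Inclusion-exclusion for the grid sum\<close>

lemma grid_sum_Un: "grid_sum C \<epsilon> (A \<union> B) = grid_sum C \<epsilon> A + grid_sum C \<epsilon> B - grid_sum C \<epsilon> (A \<inter> B)"
proof -
  have "indicator (A \<union> B) x = indicator A x + indicator B x - (indicator (A \<inter> B) x :: real)"
    for x :: "real ^ 'a"
    by (auto simp: indicator_def)
  then show ?thesis
    by (simp only: grid_sum_def sum.distrib sum_subtractf ring_distribs)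
qed

text \<open>The new corners are coordinatewise maxima and minima of the old ones, so no new grid
  values arise; nonemptiness keeps them in order.\<close>

lemma grid_boxes_Int:
  fixes A B :: "(real ^ 'n::finite) set"
  assumes "A \<in> grid_boxes C" "B \<in> grid_boxes C" "A \<inter> B \<noteq> {}"
  shows "A \<inter> B \<in> grid_boxes C"
proof -
  obtain a b c d where A: "A = cbox a b" "\<And>i. a $ i \<in> C \<and> b $ i \<in> C"
    and B: "B = cbox c d" "\<And>i. c $ i \<in> C \<and> d $ i \<in> C"
    using assms(1,2) unfolding grid_boxes_def by blast
  define l u :: "real ^ 'n"
    where "l = (\<chi> i. max (a $ i) (c $ i))" and "u = (\<chi> i. min (b $ i) (d $ i))"
  have eq: "A \<inter> B = cbox l u"
    by (auto simp: A B l_def u_def mem_box_cart)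
  then have "l $ i \<le> u $ i" for i
    using assms(3) by (auto simp: interval_ne_empty_cart)
  moreover have "l $ i \<in> C \<and> u $ i \<in> C" for i
    using A(2)[of i] B(2)[of i] by (simp add: l_def u_def max_def min_def)
  ultimately show ?thesis
    unfolding eq grid_boxes_def by blast
qed

text \<open>Both sides satisfy inclusion-exclusion. After splitting off a box \<open>B\<close>, the
  rest of the union and its intersection with \<open>B\<close> are unions of fewer boxes, so
  induction on the number of boxes reduces the claim to a single one.\<close>

lemma grid_sum_eq_measure:
  fixes \<B> :: "(real ^ 'n::finite) set set"
  assumes C: "finite C" "\<epsilon> > 0" "\<And>c c'. c \<in> C \<Longrightarrow> c' \<in> C \<Longrightarrow> c \<noteq> c' \<Longrightarrow> \<epsilon> < \<bar>c - c'\<bar>"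
    and "finite \<B>" "\<B> \<subseteq> grid_boxes C"
  shows "measure lebesgue (\<Union>\<B>) = (- 1) ^ CARD('n) * grid_sum C \<epsilon> (\<Union>\<B>)"
  using assms(4,5)
proof (induction "card \<B>" arbitrary: \<B> rule: less_induct)
  case less
  show ?case
  proof (cases "\<B> = {}")
    case True
    then show ?thesis by (simp add: grid_sum_def)
  next
    case False
    then obtain B where B: "B \<in> \<B>" by blast
    define \<A> where "\<A> = \<B> - {B}"
    \<comment> \<open>Empty traces on \<open>B\<close> are removed because every member of
      \<open>grid_boxes C\<close> is nonempty.\<close>
    define \<D> where "\<D> = (\<lambda>A. A \<inter> B) ` \<A> - {{}}"
    have fin: "finite \<A>" "finite \<D>" using less.prems by (auto simp: \<A>_def \<D>_def)
    have card_\<A>: "card \<A> < card \<B>"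
      using B less.prems by (metis \<A>_def card_Diff1_less)
    have "card \<D> \<le> card ((\<lambda>A. A \<inter> B) ` \<A>)"
      unfolding \<D>_def using fin(1) by (intro card_mono) auto
    also have "\<dots> \<le> card \<A>" by (rule card_image_le[OF fin(1)])
    finally have card_\<D>: "card \<D> < card \<B>" using card_\<A> by simp
    have \<A>: "\<A> \<subseteq> grid_boxes C" and B': "B \<in> grid_boxes C"
      using less.prems B by (auto simp: \<A>_def)
    then have \<D>: "\<D> \<subseteq> grid_boxes C"
      unfolding \<D>_def using grid_boxes_Int by blast
    have meas: "A \<in> lmeasurable" if "A \<in> grid_boxes C" for A :: "(real ^ 'n) set"
      using that by (auto simp: grid_boxes_def)
    have un: "\<Union>\<B> = \<Union>\<A> \<union> B" and inter: "\<Union>\<A> \<inter> B = \<Union>\<D>"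
      using B by (auto simp: \<A>_def \<D>_def)
    obtain a b where ab: "B = cbox a b" "\<And>i. a $ i \<in> C \<and> b $ i \<in> C \<and> a $ i \<le> b $ i"
      using B' unfolding grid_boxes_def by blast
    have "\<Union>\<A> \<in> lmeasurable" using \<A> meas fin(1) by (intro fmeasurable.finite_Union) auto
    then have "measure lebesgue (\<Union>\<A> \<union> B)
        = measure lebesgue (\<Union>\<A>) + measure lebesgue B - measure lebesgue (\<Union>\<A> \<inter> B)"
      using meas[OF B'] by (rule measure_Un3)
    also have "\<dots> = (- 1) ^ CARD('n) * grid_sum C \<epsilon> (\<Union>\<A>) + (- 1) ^ CARD('n) * grid_sum C \<epsilon> B
        - (- 1) ^ CARD('n) * grid_sum C \<epsilon> (\<Union>\<A> \<inter> B)"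
      using less.hyps[OF card_\<A> fin(1) \<A>] less.hyps[OF card_\<D> fin(2) \<D>]
        grid_sum_cbox[OF C ab(2)] ab(1) inter by simp
    also have "\<dots> = (- 1) ^ CARD('n) * grid_sum C \<epsilon> (\<Union>\<A> \<union> B)"
      by (simp add: grid_sum_Un algebra_simps)
    finally show ?thesis by (simp add: un)
  qed
qed

section \<open>Tangent cones and vertices of a union of grid boxes\<close>

text \<open>Boxes cannot tell apart two points in the same cell of the grid. This allows moving a
  point between grid hyperplanes without changing membership.\<close>

lemma mem_Union_grid_boxes_cong:
  assumes "\<B> \<subseteq> pure_grid_boxes C"
    and "\<And>i c. c \<in> C \<Longrightarrow> (c \<le> x $ i \<longleftrightarrow> c \<le> y $ i) \<and> (x $ i \<le> c \<longleftrightarrow> y $ i \<le> c)"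
  shows "x \<in> \<Union>\<B> \<longleftrightarrow> y \<in> \<Union>\<B>"
proof -
  have "x \<in> B \<longleftrightarrow> y \<in> B" if B: "B \<in> \<B>" for B
  proof -
    obtain a b where "B = cbox a b" "\<And>i. a $ i \<in> C \<and> b $ i \<in> C \<and> a $ i < b $ i"
      using B assms(1) unfolding pure_grid_boxes_def by blast
    then show ?thesis using assms(2) by (simp add: mem_box_cart)
  qed
  then show ?thesis by blast
qed

text \<open>The sign in coordinate \<open>i\<close> is that of \<open>x $ i\<close>; if
  \<open>x $ i = 0\<close>, it points to a side with room in the box, which exists since
  \<open>a $ i < b $ i\<close>. Going out to distance \<open>\<delta>\<close> crosses no endpoint,
  as those other than \<open>v $ i\<close> are farther away.\<close>

lemma sign_scaled_in_cbox:
  fixes v x :: "real ^ 'n::finite"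
  assumes "\<And>i. a $ i < b $ i" "\<And>i c. c \<in> {a $ i, b $ i} \<Longrightarrow> c \<noteq> v $ i \<Longrightarrow> \<delta> < \<bar>c - v $ i\<bar>"
    and "x \<in> centered_cube \<delta>" "v + x \<in> cbox a b" "\<delta> > 0"
  obtains s where "sign_function s" "x \<in> orthant s" "v + \<delta> *\<^sub>R (\<chi> i. s i) \<in> cbox a b"
proof -
  have "\<exists>\<sigma>. (\<sigma> = 1 \<or> \<sigma> = -1) \<and> \<sigma> * x $ i \<ge> 0 \<and> a $ i \<le> v $ i + \<delta> * \<sigma> \<and> v $ i + \<delta> * \<sigma> \<le> b $ i" for i
  proof -
    have *: "- \<delta> \<le> x $ i" "x $ i \<le> \<delta>" "a $ i \<le> v $ i + x $ i" "v $ i + x $ i \<le> b $ i"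
      using assms(3,4) by (auto simp: centered_cube_def mem_box_cart)
    show ?thesis
    proof (cases "x $ i > 0 \<or> x $ i = 0 \<and> v $ i < b $ i")
      case True
      then show ?thesis
        using * assms(1,5) assms(2)[of "a $ i" i] assms(2)[of "b $ i" i] by (intro exI[of _ 1]) auto
    next
      case False
      then show ?thesis
        using * assms(1)[of i] assms(5) assms(2)[of "a $ i" i] assms(2)[of "b $ i" i]
        by (intro exI[of _ "-1"]) auto
    qed
  qed
  then obtain s where s: "\<And>i. (s i = 1 \<or> s i = -1) \<and> s i * x $ i \<ge> 0
      \<and> a $ i \<le> v $ i + \<delta> * s i \<and> v $ i + \<delta> * s i \<le> b $ i"
    by metis
  show ?thesis
    by (rule that[of s]) (use s in \<open>auto simp: sign_function_def orthant_def mem_box_cart\<close>)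
qed

text \<open>Endpoints other than \<open>v $ i\<close> are farther than \<open>\<delta>\<close> from
  it, so a box containing the cube corner contains \<open>v\<close> too, and \<open>v + x\<close>
  lies coordinatewise between the two.\<close>

lemma cbox_of_sign_scaled:
  fixes v x :: "real ^ 'n::finite"
  assumes sep: "\<And>i c. c \<in> {a $ i, b $ i} \<Longrightarrow> c \<noteq> v $ i \<Longrightarrow> \<delta> < \<bar>c - v $ i\<bar>"
    and "x \<in> centered_cube \<delta>" "sign_function s" "x \<in> orthant s" "v + \<delta> *\<^sub>R (\<chi> i. s i) \<in> cbox a b"
  shows "v + x \<in> cbox a b"
proof -
  have "a $ i \<le> v $ i + x $ i \<and> v $ i + x $ i \<le> b $ i" for i
  proof -
    have "- \<delta> \<le> x $ i" "x $ i \<le> \<delta>" "s i * x $ i \<ge> 0"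
      "a $ i \<le> v $ i + \<delta> * s i" "v $ i + \<delta> * s i \<le> b $ i"
      using assms by (auto simp: centered_cube_def mem_box_cart orthant_def)
    moreover have "s i = 1 \<or> s i = -1" using assms(3) by (simp add: sign_function_def)
    ultimately show ?thesis
      using sep[of "a $ i" i] sep[of "b $ i" i] by (cases "a $ i = v $ i"; cases "b $ i = v $ i") auto
  qed
  then show ?thesis by (simp add: mem_box_cart)
qed

text \<open>The corners of a small cube about \<open>v\<close> serve as test points for the orthants
  in the cone. This also covers \<open>v\<close> outside the union, where the cone is empty.\<close>

lemma grid_tangent_cone:
  fixes v :: "real ^ 'n::finite"
  assumes "\<B> \<subseteq> pure_grid_boxes C" "\<delta> > 0"
    and sep: "\<And>i c. c \<in> C \<Longrightarrow> c \<noteq> v $ i \<Longrightarrow> \<delta> < \<bar>c - v $ i\<bar>"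
  shows "tangent_cone (\<Union>\<B>) v
    = (\<Union>s\<in>{s. sign_function s \<and> v + \<delta> *\<^sub>R (\<chi> i. s i) \<in> \<Union>\<B>}. orthant s)"
    (is "_ = ?\<alpha>")
proof (rule tangent_cone_eqI)
  show "local_arrangement ?\<alpha>" by (rule local_arrangement_UN_orthant) simp
  show "\<delta> > 0" by fact
next
  fix x :: "real ^ 'n" assume x: "x \<in> centered_cube \<delta>"
  show "v + x \<in> \<Union>\<B> \<longleftrightarrow> x \<in> ?\<alpha>"
  proof
    assume "v + x \<in> \<Union>\<B>"
    then obtain B where B: "B \<in> \<B>" "v + x \<in> B" by blast
    then obtain a b where ab: "B = cbox a b" "\<And>i. a $ i \<in> C \<and> b $ i \<in> C \<and> a $ i < b $ i"
      using assms(1) unfolding pure_grid_boxes_def by blast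
    obtain s where "sign_function s" "x \<in> orthant s" "v + \<delta> *\<^sub>R (\<chi> i. s i) \<in> cbox a b"
      by (rule sign_scaled_in_cbox[of a b v \<delta> x]) (use ab B sep x assms(2) in auto)
    then show "x \<in> ?\<alpha>" using ab B by blast
  next
    assume "x \<in> ?\<alpha>"
    then obtain s B where s: "sign_function s" "x \<in> orthant s" "B \<in> \<B>" "v + \<delta> *\<^sub>R (\<chi> i. s i) \<in> B"
      by blast
    then obtain a b where ab: "B = cbox a b" "\<And>i. a $ i \<in> C \<and> b $ i \<in> C \<and> a $ i < b $ i"
      using assms(1) unfolding pure_grid_boxes_def by blast
    have "v + x \<in> cbox a b"
      by (rule cbox_of_sign_scaled[of a b v \<delta> x s]) (use ab s sep x in auto)
    then show "v + x \<in> \<Union>\<B>" using ab s by blast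
  qed
qed

lemma grid_signed_volume:
  fixes v :: "real ^ 'n::finite"
  assumes "\<B> \<subseteq> pure_grid_boxes C" "\<delta> > 0" "\<And>i c. c \<in> C \<Longrightarrow> c \<noteq> v $ i \<Longrightarrow> \<delta> < \<bar>c - v $ i\<bar>"
  shows "signed_volume (tangent_cone (\<Union>\<B>) v)
    = (\<Sum>s | sign_function s. (\<Prod>i\<in>UNIV. s i) * indicator (\<Union>\<B>) (v + \<delta> *\<^sub>R (\<chi> i. s i)))"
proof -
  have "signed_volume (tangent_cone (\<Union>\<B>) v)
      = (\<Sum>s | sign_function s \<and> v + \<delta> *\<^sub>R (\<chi> i. s i) \<in> \<Union>\<B>. \<Prod>i\<in>UNIV. s i)"
    using signed_volume_UN_orthant[of "{s. sign_function s \<and> v + \<delta> *\<^sub>R (\<chi> i. s i) \<in> \<Union>\<B>}"]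
      grid_tangent_cone[OF assms] by simp
  also have "\<dots> = (\<Sum>s | sign_function s. (\<Prod>i\<in>UNIV. s i) * indicator (\<Union>\<B>) (v + \<delta> *\<^sub>R (\<chi> i. s i)))"
    using finite_sign_functions by (intro sum.mono_neutral_cong_left) auto
  finally show ?thesis .
qed

section \<open>Points of nonzero signed volume and their genericity regions\<close>

lemma grid_separation:
  fixes v :: "real ^ 'n::finite"
  assumes "finite C"
  obtains \<delta> where "\<delta> > 0" "\<And>i c. c \<in> C \<Longrightarrow> c \<noteq> v $ i \<Longrightarrow> \<delta> < \<bar>c - v $ i\<bar>"
proof -
  define D where "D = (\<Union>i. (\<lambda>c. \<bar>c - v $ i\<bar>) ` C)"
  have "finite D" using assms by (simp add: D_def)
  then obtain e where e: "e > 0" "\<forall>x\<in>D. x \<noteq> 0 \<longrightarrow> e \<le> dist 0 x"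
    using finite_set_avoid[of D 0] by blast
  \<comment> \<open>\<open>finite_set_avoid\<close> bounds the nonzero distances below by
    \<open>e\<close> only weakly; halving makes the inequality strict.\<close>
  show ?thesis
  proof (rule that[of "e / 2"])
    show "e / 2 < \<bar>c - v $ i\<bar>" if "c \<in> C" "c \<noteq> v $ i" for i c
    proof -
      have "\<bar>c - v $ i\<bar> \<in> D" using that(1) unfolding D_def by blast
      then have "e \<le> \<bar>c - v $ i\<bar>" using e(2) that(2) by fastforce
      then show ?thesis using e(1) by linarith
    qed
  qed (use e in simp)
qed

text \<open>A grid value is either \<open>v $ j\<close>, which \<open>y $ j\<close> avoids, or
  farther than \<open>\<delta>\<close> from \<open>v $ j\<close>. So near \<open>y\<close> the union
  does not depend on coordinate \<open>j\<close>.\<close>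

lemma nearby_tangent_cone_reflect:
  fixes v y :: "real ^ 'n::finite"
  assumes \<B>: "\<B> \<subseteq> pure_grid_boxes C" and "finite C"
    and sep: "\<And>c. c \<in> C \<Longrightarrow> c \<noteq> v $ j \<Longrightarrow> \<delta> < \<bar>c - v $ j\<bar>"
    and y: "y $ j \<noteq> v $ j" "\<bar>y $ j - v $ j\<bar> < \<delta>"
  shows "reflect j ` tangent_cone (\<Union>\<B>) y \<subseteq> tangent_cone (\<Union>\<B>) y"
proof -
  obtain e where e: "e > 0" "\<And>i c. c \<in> C \<Longrightarrow> c \<noteq> y $ i \<Longrightarrow> e < \<bar>c - y $ i\<bar>"
    using grid_separation[OF assms(2)] by blast
  \<comment> \<open>Small enough to compute the cone at \<open>y\<close>, and such that the interval
    of radius \<open>\<eta>\<close> about \<open>y $ j\<close> avoids \<open>v $ j\<close> and stays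
    within \<open>\<delta>\<close> of it.\<close>
  define \<eta> where "\<eta> = Min {e, \<bar>y $ j - v $ j\<bar> / 2, (\<delta> - \<bar>y $ j - v $ j\<bar>) / 2}"
  have \<eta>: "\<eta> > 0" "\<eta> \<le> e" "\<eta> \<le> \<bar>y $ j - v $ j\<bar> / 2" "\<eta> \<le> (\<delta> - \<bar>y $ j - v $ j\<bar>) / 2"
    using e(1) y unfolding \<eta>_def by (auto simp: min_def)
  have sep': "\<eta> < \<bar>c - y $ i\<bar>" if "c \<in> C" "c \<noteq> y $ i" for i c
    using e(2)[OF that] \<eta>(2) by linarith
  have cone: "tangent_cone (\<Union>\<B>) y
      = (\<Union>s\<in>{s. sign_function s \<and> y + \<eta> *\<^sub>R (\<chi> i. s i) \<in> \<Union>\<B>}. orthant s)"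
    by (rule grid_tangent_cone[OF \<B> \<eta>(1) sep'])
  have near: "(c \<le> y $ j - \<eta> \<longleftrightarrow> c \<le> y $ j + \<eta>) \<and> (y $ j - \<eta> \<le> c \<longleftrightarrow> y $ j + \<eta> \<le> c)"
    if "c \<in> C" for c
  proof -
    have "c = v $ j \<or> c > v $ j + \<delta> \<or> c < v $ j - \<delta>" using sep[OF that] by linarith
    moreover have "y $ j > v $ j \<or> y $ j < v $ j" using y(1) by linarith
    ultimately show ?thesis using y(2) \<eta>(1,3,4) by (elim disjE) auto
  qed
  have flip: "y + \<eta> *\<^sub>R (\<chi> i. (s(j := - s j)) i) \<in> \<Union>\<B> \<longleftrightarrow> y + \<eta> *\<^sub>R (\<chi> i. s i) \<in> \<Union>\<B>"
    if "sign_function s" for s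
  proof (rule mem_Union_grid_boxes_cong[OF \<B>])
    fix i c assume c: "c \<in> C"
    have "s j = 1 \<or> s j = -1" using that by (simp add: sign_function_def)
    then show "(c \<le> (y + \<eta> *\<^sub>R (\<chi> i. (s(j := - s j)) i)) $ i \<longleftrightarrow> c \<le> (y + \<eta> *\<^sub>R (\<chi> i. s i)) $ i) \<and>
       ((y + \<eta> *\<^sub>R (\<chi> i. (s(j := - s j)) i)) $ i \<le> c \<longleftrightarrow> (y + \<eta> *\<^sub>R (\<chi> i. s i)) $ i \<le> c)"
      using near[OF c] by (cases "i = j") auto
  qed
  show ?thesis
  proof
    fix z assume "z \<in> reflect j ` tangent_cone (\<Union>\<B>) y"
    then obtain x s where s: "z = reflect j x" "x \<in> orthant s" "sign_function s"
      "y + \<eta> *\<^sub>R (\<chi> i. s i) \<in> \<Union>\<B>"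
      unfolding cone by blast
    then have "z \<in> orthant (s(j := - s j))" "sign_function (s(j := - s j))"
      "y + \<eta> *\<^sub>R (\<chi> i. (s(j := - s j)) i) \<in> \<Union>\<B>"
      by (simp_all only: reflect_in_orthant_flip sign_function_flip flip)
    then show "z \<in> tangent_cone (\<Union>\<B>) y" unfolding cone by blast
  qed
qed

text \<open>If the genericity region of a point contains a second point, then it contains points
  arbitrarily close to the first one but different from it. Near such a point the union of boxes is
  invariant in some coordinate direction, and congruence transports this to the first point.\<close>

lemma genericity_region_singleton:
  fixes v :: "real ^ 'n::finite"
  assumes \<B>: "\<B> \<subseteq> pure_grid_boxes C" and "finite C"
    and nz: "signed_volume (tangent_cone (\<Union>\<B>) v) \<noteq> 0"
  shows "genericity_region (\<Union>\<B>) v \<subseteq> {v}"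
proof
  fix w assume "w \<in> genericity_region (\<Union>\<B>) v"
  then obtain \<gamma> where \<gamma>: "path \<gamma>" "pathstart \<gamma> = v" "pathfinish \<gamma> = w"
    "\<And>y. y \<in> path_image \<gamma> \<Longrightarrow> congruent_cones (tangent_cone (\<Union>\<B>) y) (tangent_cone (\<Union>\<B>) v)"
    unfolding genericity_region_def by blast
  show "w \<in> {v}"
  proof (rule ccontr)
    assume "w \<notin> {v}"
    obtain \<delta> where \<delta>: "\<delta> > 0" "\<And>i c. c \<in> C \<Longrightarrow> c \<noteq> v $ i \<Longrightarrow> \<delta> < \<bar>c - v $ i\<bar>"
      using grid_separation[OF assms(2)] by blast
    have "v \<in> path_image \<gamma>" "w \<in> path_image \<gamma>" using \<gamma> by auto
    moreover have "connected (path_image \<gamma>)" using \<gamma>(1) by (rule connected_path_image)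
    ultimately have "v islimpt path_image \<gamma>"
      using \<open>w \<notin> {v}\<close> by (intro connected_imp_perfect) auto
    then obtain y where y: "y \<in> path_image \<gamma>" "y \<noteq> v" "dist y v < \<delta>"
      using \<delta>(1) unfolding islimpt_approachable by blast
    then obtain j where j: "y $ j \<noteq> v $ j" by (auto simp: vec_eq_iff)
    have "\<bar>y $ j - v $ j\<bar> < \<delta>"
      using y(3) component_le_norm_cart[of "y - v" j] by (simp add: dist_norm)
    then have "reflect j ` tangent_cone (\<Union>\<B>) y \<subseteq> tangent_cone (\<Union>\<B>) y"
      by (intro nearby_tangent_cone_reflect[OF \<B> assms(2) \<delta>(2) j])
    then obtain k where "reflect k ` tangent_cone (\<Union>\<B>) v \<subseteq> tangent_cone (\<Union>\<B>) v"
      using congruent_reflect_invariant \<gamma>(4)[OF y(1)] by blast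
    then show False using signed_volume_reflect_invariant nz by blast
  qed
qed

section \<open>Points of degree zero\<close>

lemma degree_eq_0I:
  assumes "genericity_region P v \<subseteq> {v}"
  shows "degree P v = 0"
proof -
  have "coordinate_flat UNIV (vec_nth v) = {v}"
    by (auto simp: coordinate_flat_def vec_eq_iff)
  then have "\<exists>I c. genericity_region P v \<subseteq> coordinate_flat I c \<and> aff_dim (coordinate_flat I c) = int 0"
    using assms by (intro exI[of _ UNIV] exI[of _ "vec_nth v"]) simp
  then show ?thesis unfolding degree_def by (rule Least_eq_0)
qed

lemma degree_eq_0D:
  fixes P :: "(real ^ 'n::finite) set"
  assumes "degree P v = 0"
  obtains u where "genericity_region P v \<subseteq> {u}"
proof -
  let ?Q = "\<lambda>k. \<exists>I c. genericity_region P v \<subseteq> coordinate_flat I c \<and> aff_dim (coordinate_flat I c) = int k"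
  \<comment> \<open>The whole space is a flat containing the region, so the least dimension is
    attained.\<close>
  have "?Q (DIM(real ^ 'n))"
    by (intro exI[of _ "{}"] exI[of _ "\<lambda>_. 0"]) (simp add: coordinate_flat_def)
  then have "?Q (degree P v)" unfolding degree_def by (rule LeastI)
  then show ?thesis using assms that by (auto simp: aff_dim_eq_0)
qed

text \<open>If \<open>v $ j\<close> is no grid value, the union is locally invariant in direction
  \<open>j\<close>. The tangent cone is then constant along a segment from \<open>v\<close>, which
  puts a second point into the genericity region.\<close>

lemma vertices_in_grid:
  fixes v :: "real ^ 'n::finite"
  assumes \<B>: "\<B> \<subseteq> pure_grid_boxes C" and "finite C" and v: "v \<in> vertices (\<Union>\<B>)"
  shows "v $ j \<in> C"
proof (rule ccontr)
  assume j: "v $ j \<notin> C"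
  obtain \<delta> where \<delta>: "\<delta> > 0" "\<And>i c. c \<in> C \<Longrightarrow> c \<noteq> v $ i \<Longrightarrow> \<delta> < \<bar>c - v $ i\<bar>"
    using grid_separation[OF assms(2)] by blast
  have vP: "v \<in> \<Union>\<B>" and "degree (\<Union>\<B>) v = 0" using v by (auto simp: vertices_def)
  then obtain u where u: "genericity_region (\<Union>\<B>) v \<subseteq> {u}" using degree_eq_0D by blast
  \<comment> \<open>With half of \<open>\<delta>\<close>, a shift along \<open>e\<close> followed by
    a step in a cube of radius \<open>\<delta> / 2\<close> stays within \<open>\<delta>\<close> of
    \<open>v $ j\<close> in coordinate \<open>j\<close> and crosses no grid value.\<close>
  define e :: "real ^ 'n" where "e = axis j (\<delta> / 2)"
  have sep: "\<delta> / 2 < \<bar>c - (v + t *\<^sub>R e) $ i\<bar>"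
    if "c \<in> C" "c \<noteq> (v + t *\<^sub>R e) $ i" "0 \<le> t" "t \<le> 1" for t c i
  proof (cases "i = j")
    case True
    have "\<delta> < \<bar>c - v $ j\<bar>" using \<delta>(2)[OF that(1)] that(1) j by metis
    moreover have "\<bar>t * \<delta> / 2\<bar> \<le> \<delta> / 2"
      using that(3,4) \<delta>(1) by (simp add: mult_left_le_one_le)
    ultimately show ?thesis using True by (simp add: e_def axis_def abs_if split: if_splits)
  next
    case False
    then show ?thesis using that \<delta>(1) \<delta>(2)[of c i] by (simp add: e_def axis_def)
  qed
  have shift: "v + t *\<^sub>R e + z \<in> \<Union>\<B> \<longleftrightarrow> v + z \<in> \<Union>\<B>"
    if "\<bar>z $ j\<bar> \<le> \<delta> / 2" "0 \<le> t" "t \<le> 1" for t z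
  proof (rule mem_Union_grid_boxes_cong[OF \<B>])
    fix i c assume c: "c \<in> C"
    have "\<delta> < \<bar>c - v $ j\<bar>" using \<delta>(2)[OF c] c j by metis
    moreover have "\<bar>t * \<delta> / 2\<bar> \<le> \<delta> / 2"
      using that(2,3) \<delta>(1) by (simp add: mult_left_le_one_le)
    ultimately show "(c \<le> (v + t *\<^sub>R e + z) $ i \<longleftrightarrow> c \<le> (v + z) $ i)
        \<and> ((v + t *\<^sub>R e + z) $ i \<le> c \<longleftrightarrow> (v + z) $ i \<le> c)"
      using that(1) by (cases "i = j") (simp_all add: e_def axis_def, linarith)
  qed
  \<comment> \<open>The test points move along with \<open>t\<close> without changing
    membership.\<close>
  have cone: "tangent_cone (\<Union>\<B>) (v + t *\<^sub>R e)
      = (\<Union>s\<in>{s. sign_function s \<and> v + (\<delta> / 2) *\<^sub>R (\<chi> i. s i) \<in> \<Union>\<B>}. orthant s)"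
    if t: "0 \<le> t" "t \<le> 1" for t
  proof -
    have "\<bar>((\<delta> / 2) *\<^sub>R (\<chi> i. s i)) $ j\<bar> \<le> \<delta> / 2" if "sign_function s" for s
      using that \<delta>(1) by (cases "s j = 1") (auto simp: sign_function_def)
    then have "{s. sign_function s \<and> v + t *\<^sub>R e + (\<delta> / 2) *\<^sub>R (\<chi> i. s i) \<in> \<Union>\<B>}
        = {s. sign_function s \<and> v + (\<delta> / 2) *\<^sub>R (\<chi> i. s i) \<in> \<Union>\<B>}"
      by (intro Collect_cong conj_cong refl shift t)
    then show ?thesis
      using grid_tangent_cone[OF \<B> _ sep, of t] \<delta>(1) t by simp
  qed
  have region: "v + t *\<^sub>R e \<in> genericity_region (\<Union>\<B>) v" if t: "0 \<le> t" "t \<le> 1" for t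
  proof -
    define \<gamma> where "\<gamma> = linepath v (v + t *\<^sub>R e)"
    have im: "\<exists>r. y = v + r *\<^sub>R e \<and> 0 \<le> r \<and> r \<le> 1" if y: "y \<in> path_image \<gamma>" for y
    proof -
      obtain q where q: "0 \<le> q" "q \<le> 1" "y = (1 - q) *\<^sub>R v + q *\<^sub>R (v + t *\<^sub>R e)"
        using y by (auto simp: \<gamma>_def closed_segment_def)
      then have "y = v + (q * t) *\<^sub>R e" by (simp add: algebra_simps)
      then show ?thesis using q t by (intro exI[of _ "q * t"]) (auto simp: mult_le_one)
    qed
    have "v + r *\<^sub>R e \<in> \<Union>\<B>" if "0 \<le> r" "r \<le> 1" for r
      using shift[of 0 r] vP \<delta>(1) that by simp
    then have "path_image \<gamma> \<subseteq> \<Union>\<B>"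
      using im by blast
    moreover have "congruent_cones (tangent_cone (\<Union>\<B>) y) (tangent_cone (\<Union>\<B>) v)"
      if "y \<in> path_image \<gamma>" for y
    proof -
      have "tangent_cone (\<Union>\<B>) y = tangent_cone (\<Union>\<B>) v"
        using im[OF that] cone cone[of 0] by auto
      then show ?thesis by (simp add: congruent_cones_refl)
    qed
    moreover have "path \<gamma>" "pathstart \<gamma> = v" "pathfinish \<gamma> = v + t *\<^sub>R e"
      by (simp_all add: \<gamma>_def)
    ultimately show ?thesis
      unfolding genericity_region_def by blast
  qed
  have "v + 0 *\<^sub>R e = u" "v + 1 *\<^sub>R e = u"
    using u region[of 0] region[of 1] by auto
  then have "v + e = v" by simp
  then show False using \<delta>(1) by (simp add: e_def axis_eq_0_iff)
qed

section \<open>Assembly of the volume formula\<close>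

lemma pure_orthogonal_polytope_grid:
  fixes P :: "(real ^ 'n::finite) set"
  assumes "pure_orthogonal_polytope P"
  obtains C \<B> where "finite C" "finite \<B>" "\<B> \<subseteq> pure_grid_boxes C" "P = \<Union>\<B>"
proof -
  obtain \<B> where \<B>: "finite \<B>" "\<forall>B\<in>\<B>. \<exists>a b. (\<forall>i. a $ i < b $ i) \<and> B = cbox a b" "P = \<Union>\<B>"
    using assms unfolding pure_orthogonal_polytope_def by blast
  then obtain a b :: "(real ^ 'n) set \<Rightarrow> real ^ 'n"
    where ab: "\<And>B. B \<in> \<B> \<Longrightarrow> (\<forall>i. a B $ i < b B $ i) \<and> B = cbox (a B) (b B)"
    by metis
  define C where "C = (\<Union>B\<in>\<B>. \<Union>i. {a B $ i, b B $ i})"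
  have "\<B> \<subseteq> pure_grid_boxes C"
  proof
    fix B assume "B \<in> \<B>"
    moreover from this have "\<forall>i. a B $ i \<in> C \<and> b B $ i \<in> C" unfolding C_def by blast
    ultimately show "B \<in> pure_grid_boxes C"
      using ab unfolding pure_grid_boxes_def by blast
  qed
  moreover have "finite C" using \<B>(1) by (simp add: C_def)
  ultimately show ?thesis using that \<B> by blast
qed

theorem theorem4p8:
  fixes P :: "(real ^ 'n::finite) set"
  assumes "generic_orthotope P" and "rational_polytope P"
  shows "measure lebesgue P =
    (- 1) ^ CARD('n) * (\<Sum>v\<in>vertices P. signed_volume (tangent_cone P v) * (\<Prod>i\<in>UNIV. v $ i))"
proof -
  obtain C \<B> where C: "finite C" and "finite \<B>" and \<B>: "\<B> \<subseteq> pure_grid_boxes C" and P: "P = \<Union>\<B>"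
    using assms(1) pure_orthogonal_polytope_grid unfolding generic_orthotope_def by blast
  \<comment> \<open>Separating the differences from 0 gives one \<open>\<delta>\<close> below all
    gaps of \<open>C\<close>, usable at every grid point at once.\<close>
  have "finite ((\<lambda>(c, c'). c - c') ` (C \<times> C))" using C by simp
  then obtain \<delta> where \<delta>: "\<delta> > 0" "\<And>x. x \<in> (\<lambda>(c, c'). c - c') ` (C \<times> C) \<Longrightarrow> x \<noteq> 0 \<Longrightarrow> \<delta> < \<bar>x - 0\<bar>"
    using grid_separation[of _ "0 :: real ^ 'n"] by (metis zero_index)
  have sep: "\<delta> < \<bar>c - c'\<bar>" if "c \<in> C" "c' \<in> C" "c \<noteq> c'" for c c'
    using \<delta>(2)[of "c - c'"] that by force
  have "B \<in> grid_boxes C" if "B \<in> \<B>" for B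
    using that \<B> less_imp_le unfolding pure_grid_boxes_def grid_boxes_def by blast
  then have "measure lebesgue P = (- 1) ^ CARD('n) * grid_sum C \<delta> P"
    unfolding P by (intro grid_sum_eq_measure[OF C \<delta>(1) sep \<open>finite \<B>\<close>]) auto
  moreover have "grid_sum C \<delta> P
      = (\<Sum>v | \<forall>i. v $ i \<in> C. signed_volume (tangent_cone P v) * (\<Prod>i\<in>UNIV. v $ i))"
    unfolding grid_sum_def P
    by (intro sum.cong) (auto simp: grid_signed_volume[OF \<B> \<delta>(1)] sep)
  moreover have "(\<Sum>v\<in>vertices P. signed_volume (tangent_cone P v) * (\<Prod>i\<in>UNIV. v $ i))
      = (\<Sum>v | \<forall>i. v $ i \<in> C. signed_volume (tangent_cone P v) * (\<Prod>i\<in>UNIV. v $ i))"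
  proof (rule sum.mono_neutral_left)
    show "finite {v :: real ^ 'n. \<forall>i. v $ i \<in> C}" by (rule finite_grid_points[OF C])
    show "vertices P \<subseteq> {v. \<forall>i. v $ i \<in> C}"
      using vertices_in_grid[OF \<B> C] P by blast
    show "\<forall>v\<in>{v. \<forall>i. v $ i \<in> C} - vertices P.
        signed_volume (tangent_cone P v) * (\<Prod>i\<in>UNIV. v $ i) = 0"
    proof
      fix v assume v: "v \<in> {v. \<forall>i. v $ i \<in> C} - vertices P"
      have "signed_volume (tangent_cone P v) = 0"
      proof (rule ccontr)
        assume nz: "signed_volume (tangent_cone P v) \<noteq> 0"
        \<comment> \<open>Nonzero signed volume forces degree 0, so the non-vertex \<open>v\<close>
          lies outside \<open>P\<close>; but there no test point lies in \<open>P\<close>, and the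
          signed volume is 0 after all.\<close>
        then have "degree P v = 0"
          unfolding P by (intro degree_eq_0I genericity_region_singleton[OF \<B> C])
        then have "v \<notin> P" using v by (auto simp: vertices_def)
        have "v + \<delta> *\<^sub>R (\<chi> i. s i) \<notin> P" if s: "sign_function s" for s
        proof
          assume "v + \<delta> *\<^sub>R (\<chi> i. s i) \<in> P"
          then obtain a b where ab: "cbox a b \<in> \<B>" "v + \<delta> *\<^sub>R (\<chi> i. s i) \<in> cbox a b"
            "\<And>i. a $ i \<in> C \<and> b $ i \<in> C \<and> a $ i < b $ i"
            using \<B> P unfolding pure_grid_boxes_def by blast
          have "v + 0 \<in> cbox a b"
            by (rule cbox_of_sign_scaled[of a b v \<delta> 0 s])
              (use ab s sep v \<delta>(1) in \<open>auto simp: centered_cube_def orthant_def\<close>)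
          then show False using ab \<open>v \<notin> P\<close> P by auto
        qed
        then have "signed_volume (tangent_cone P v) = 0"
          using grid_signed_volume[OF \<B> \<delta>(1), of v] sep v P by (auto simp: indicator_def)
        with nz show False by blast
      qed
      then show "signed_volume (tangent_cone P v) * (\<Prod>i\<in>UNIV. v $ i) = 0" by simp
    qed
  qed
  ultimately show ?thesis by simp
qed

end
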